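(* Let $X$ be a $W$-hyperbolic space, $C\subseteq X$ a convex subset, $T:C\to C$ a nonexpansive mapping with a fixed point $p$, and $u,y_0\in C$. Let $\lambda\in(0,1]$, $\lambda_n=\lambda$ for all $n\in\mathbb N$, $\beta_1=0$ and $\beta_n=1-\frac2n$ for $n\ge2$. Let $(y_n)$ be the modified Halpern iteration starting with $y_0$ for these scalars. Let $M\ge1$ be an integer such that $M\ge4\max\{d(u,p),d(y_0,p)\}$. Then for all $n\ge0$, $$d(y_{n+1},y_n)\le\frac{2M}{n+1},\qquad d(y_n,Ty_n)\le\frac{4M}{\lambda(n+1)}.$$
   Context: A $W$-space is a metric space $(X,d)$ with a function $W:X\times X\times[0,1]\to X$; one writes $(1-\lambda)x+\lambda y$ for $W(x,y,\lambda)$. It is a $W$-hyperbolic space if for all $x,y,z,w\in X$ and $\lambda,\tilde\lambda\in[0,1]$: (W1) $d(z,(1-\lambda)x+\lambda y)\le(1-\lambda)d(z,x)+\lambda d(z,y)$; (W2) $d((1-\lambda)x+\lambda y,(1-\tilde\lambda)x+\tilde\lambda y)=|\lambda-\tilde\lambda|\,d(x,y)$; (W3) $(1-\lambda)x+\lambda y=\lambda y+(1-\lambda)x$, i.e. $W(x,y,\lambda)=W(y,x,1-\lambda)$; (W4) $d((1-\lambda)x+\lambda z,(1-\lambda)y+\lambda w)\le(1-\lambda)d(x,y)+\lambda d(z,w)$. A nonempty $C\subseteq X$ is convex if $(1-\lambda)x+\lambda y\in C$ for all $x,y\in C$, $\lambda\in[0,1]$. $T$ is nonexpansive if $d(Tx,Ty)\le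 d(x,y)$ for all $x,y\in C$. Modified Halpern iteration: for $n\in\mathbb N$, $y_{n+1}=(1-\beta_{n+1})u+\beta_{n+1}v_n$ with $v_n=(1-\lambda_n)y_n+\lambda_nTy_n$. *)

theory Defs
  imports "HOL-Analysis.Analysis"
begin

text \<open>
  The metric space is given by a carrier set \<open>X\<close> and a distance \<open>d\<close>.  The point
  \<open>(1 - l)x + ly\<close> is \<open>W x y l\<close>, so \<open>l\<close> is the weight of the second argument;
  the values of \<open>W\<close> for \<open>l \<notin> {0..1}\<close> are left unconstrained.
\<close>

locale W_space = Metric_space X d
  for X :: "'a set" and d :: "'a \<Rightarrow> 'a \<Rightarrow> real" +
  fixes W :: "'a \<Rightarrow> 'a \<Rightarrow> real \<Rightarrow> 'a"
  assumes W_closed: "\<lbrakk>x \<in> X; y \<in> X; l \<in> {0..1}\<rbrakk> \<Longrightarrow> W x y l \<in> X"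

locale W_hyperbolic_space = W_space X d W
  for X :: "'a set" and d :: "'a \<Rightarrow> 'a \<Rightarrow> real" and W :: "'a \<Rightarrow> 'a \<Rightarrow> real \<Rightarrow> 'a" +
  assumes W1: "\<lbrakk>x \<in> X; y \<in> X; z \<in> X; l \<in> {0..1}\<rbrakk> \<Longrightarrow>
      d z (W x y l) \<le> (1 - l) * d z x + l * d z y"
    and W2: "\<lbrakk>x \<in> X; y \<in> X; l \<in> {0..1}; m \<in> {0..1}\<rbrakk> \<Longrightarrow>
      d (W x y l) (W x y m) = \<bar>l - m\<bar> * d x y"
    and W3: "\<lbrakk>x \<in> X; y \<in> X; l \<in> {0..1}\<rbrakk> \<Longrightarrow> W x y l = W y x (1 - l)"
    and W4: "\<lbrakk>x \<in> X; y \<in> X; z \<in> X; w \<in> X; l \<in> {0..1}\<rbrakk> \<Longrightarrow>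
      d (W x z l) (W y w l) \<le> (1 - l) * d x y + l * d z w"

definition W_convex :: "'a set \<Rightarrow> ('a \<Rightarrow> 'a \<Rightarrow> real \<Rightarrow> 'a) \<Rightarrow> 'a set \<Rightarrow> bool" where
  "W_convex X W C \<longleftrightarrow>
    C \<noteq> {} \<and> C \<subseteq> X \<and> (\<forall>x\<in>C. \<forall>y\<in>C. \<forall>l\<in>{0..1}. W x y l \<in> C)"

definition nonexpansive_on :: "'a set \<Rightarrow> ('a \<Rightarrow> 'a \<Rightarrow> real) \<Rightarrow> ('a \<Rightarrow> 'a) \<Rightarrow> bool" where
  "nonexpansive_on C d T \<longleftrightarrow> (\<forall>x\<in>C. \<forall>y\<in>C. d (T x) (T y) \<le> d x y)"

text \<open>The scalars \<open>lam\<^sub>n\<close> are indexed from 0, the scalars \<open>\<beta>\<^sub>n\<close> from 1; \<open>\<beta> 0\<close> is never used.\<close>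

primrec modified_halpern ::
  "('a \<Rightarrow> 'a \<Rightarrow> real \<Rightarrow> 'a) \<Rightarrow> ('a \<Rightarrow> 'a) \<Rightarrow> 'a \<Rightarrow>
    (nat \<Rightarrow> real) \<Rightarrow> (nat \<Rightarrow> real) \<Rightarrow> 'a \<Rightarrow> nat \<Rightarrow> 'a" where
  "modified_halpern W T u lam \<beta> y\<^sub>0 0 = y\<^sub>0"
| "modified_halpern W T u lam \<beta> y\<^sub>0 (Suc n) =
    (let y = modified_halpern W T u lam \<beta> y\<^sub>0 n;
         v = W y (T y) (lam n)
     in W u v (\<beta> (Suc n)))"

end

theory Submission
  imports Defs
begin

text \<open>
  All iterates stay in the ball of radius \<open>K = max (d u p) (d y\<^sub>0 p) \<le> M / 4\<close> around \<open>p\<close>.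
  Comparing consecutive steps through (W4) and (W2) gives, for \<open>s\<^sub>n = d (y\<^sub>n\<^sub>+\<^sub>1) (y\<^sub>n)\<close>
  and \<open>v\<^sub>n = W (y\<^sub>n) (T y\<^sub>n) l\<close>,
  \<open>s\<^sub>n\<^sub>+\<^sub>1 \<le> \<beta>\<^sub>n\<^sub>+\<^sub>2 * s\<^sub>n + \<bar>\<beta>\<^sub>n\<^sub>+\<^sub>2 - \<beta>\<^sub>n\<^sub>+\<^sub>1\<bar> * d u (v\<^sub>n) \<le> n/(n+2) * s\<^sub>n + M/((n+1)(n+2))\<close>,
  and \<open>s\<^sub>n \<le> 2M/(n+1)\<close> is preserved by this recursion.  The second bound follows from
  \<open>l * d (y\<^sub>n) (T y\<^sub>n) = d (y\<^sub>n) (v\<^sub>n) \<le> s\<^sub>n + (1 - \<beta>\<^sub>n\<^sub>+\<^sub>1) * d u (v\<^sub>n)\<close>.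
\<close>

context W_hyperbolic_space
begin

text \<open>Taking \<open>z = x\<close> in (W1) makes both terms of the upper bound vanish.\<close>

lemma W_zero [simp]:
  assumes "x \<in> X" "y \<in> X"
  shows "W x y 0 = x"
proof -
  have "d x (W x y 0) \<le> 0"
    using W1[of x y x 0] assms by simp
  then show ?thesis
    using W_closed[of x y 0] assms nonneg[of x "W x y 0"] by (simp add: order_antisym)
qed

lemma W_one [simp]:
  assumes "x \<in> X" "y \<in> X"
  shows "W x y 1 = y"
  using W3[of y x 0] assms by simp

lemma dist_W_left:
  assumes "x \<in> X" "y \<in> X" "l \<in> {0..1}"
  shows "d x (W x y l) = l * d x y"
  using W2[of x y 0 l] assms by simp

lemma dist_W_right:
  assumes "x \<in> X" "y \<in> X" "l \<in> {0..1}"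
  shows "d (W x y l) y = (1 - l) * d x y"
  using W2[of x y l 1] assms by simp

text \<open>By (W1), closed balls are convex.\<close>

lemma dist_W_le:
  assumes "x \<in> X" "y \<in> X" "p \<in> X" "l \<in> {0..1}" "d x p \<le> K" "d y p \<le> K"
  shows "d (W x y l) p \<le> K"
proof -
  have "d (W x y l) p \<le> (1 - l) * d p x + l * d p y"
    using W1[of x y p l] assms by (simp add: commute)
  also have "\<dots> \<le> (1 - l) * K + l * K"
    using assms by (intro add_mono mult_left_mono) (auto simp: commute)
  finally show ?thesis by (simp add: algebra_simps)
qed

text \<open>Go through \<open>W u w a\<close>: with the anchor \<open>u\<close> shared, (W4) pays
  for changing the point and (W2) for changing the weight.\<close>

lemma dist_W_W_le:
  assumes "u \<in> X" "v \<in> X" "w \<in> X" "a \<in> {0..1}" "b \<in> {0..1}"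
  shows "d (W u v a) (W u w b) \<le> a * d v w + \<bar>a - b\<bar> * d u w"
proof -
  have "d (W u v a) (W u w b) \<le> d (W u v a) (W u w a) + d (W u w a) (W u w b)"
    using assms by (intro triangle W_closed)
  moreover have "d (W u v a) (W u w a) \<le> a * d v w"
    using W4[of u u v w a] assms by simp
  moreover have "d (W u w a) (W u w b) = \<bar>a - b\<bar> * d u w"
    using W2 assms by simp
  ultimately show ?thesis by linarith
qed

lemma nonexpansive_averaged:
  assumes "C \<subseteq> X" "T \<in> C \<rightarrow> C" "nonexpansive_on C d T" "x \<in> C" "y \<in> C" "l \<in> {0..1}"
  shows "d (W x (T x) l) (W y (T y) l) \<le> d x y"
proof -
  have X: "x \<in> X" "y \<in> X" "T x \<in> X" "T y \<in> X"
    using assms by auto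
  have "d (W x (T x) l) (W y (T y) l) \<le> (1 - l) * d x y + l * d (T x) (T y)"
    using W4 X assms by blast
  also have "\<dots> \<le> (1 - l) * d x y + l * d x y"
    using assms by (intro add_mono mult_left_mono) (auto simp: nonexpansive_on_def)
  finally show ?thesis by (simp add: algebra_simps)
qed

text \<open>As \<open>p\<close> is fixed, \<open>T\<close> maps points of \<open>C\<close> in a ball
  around \<open>p\<close> into that ball, and the ball is convex.\<close>

lemma averaged_bounded:
  assumes "C \<subseteq> X" "T \<in> C \<rightarrow> C" "nonexpansive_on C d T" "p \<in> C" "T p = p"
    and "x \<in> C" "d x p \<le> K" "l \<in> {0..1}"
  shows "d (W x (T x) l) p \<le> K"
proof (rule dist_W_le)
  show "d (T x) p \<le> K"
    using assms unfolding nonexpansive_on_def by (metis order_trans)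
qed (use assms in auto)

text \<open>Both claims share one induction: the distance bound at the next step needs the current
  iterate in \<open>C\<close>, where \<open>T\<close> is nonexpansive.\<close>

lemma modified_halpern_bounded:
  assumes C: "W_convex X W C" and T: "T \<in> C \<rightarrow> C" "nonexpansive_on C d T"
    and p: "p \<in> C" "T p = p" and u: "u \<in> C" "d u p \<le> K" and y0: "y\<^sub>0 \<in> C" "d y\<^sub>0 p \<le> K"
    and lam: "\<And>n. lam n \<in> {0..1}" and \<beta>: "\<And>n. \<beta> (Suc n) \<in> {0..1}"
  shows "modified_halpern W T u lam \<beta> y\<^sub>0 n \<in> C"
    and "d (modified_halpern W T u lam \<beta> y\<^sub>0 n) p \<le> K"
proof (induction n)
  case 0
  {
    case 1
    show ?case using y0 by simp
  next
    case 2
    show ?case using y0 by simp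
  }
next
  case (Suc n)
  define y where "y = modified_halpern W T u lam \<beta> y\<^sub>0 n"
  define v where "v = W y (T y) (lam n)"
  have y: "y \<in> C" "d y p \<le> K"
    using Suc by (simp_all add: y_def)
  have v: "v \<in> C"
    using C T(1) y lam unfolding v_def W_convex_def by (auto simp: Pi_iff)
  have CX: "C \<subseteq> X"
    using C by (simp add: W_convex_def)
  have vp: "d v p \<le> K"
    using averaged_bounded[OF CX T p y lam] by (simp add: v_def)
  have Suc_eq: "modified_halpern W T u lam \<beta> y\<^sub>0 (Suc n) = W u v (\<beta> (Suc n))"
    by (simp add: y_def v_def Let_def)
  {
    case 1
    show ?case using C u v \<beta> unfolding Suc_eq W_convex_def by blast
  next
    case 2
    show ?case
      unfolding Suc_eq using CX u v vp p \<beta> by (intro dist_W_le) auto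
  }
qed

end

theorem proposition4p7:
  fixes X C :: "'a set" and d :: "'a \<Rightarrow> 'a \<Rightarrow> real" and W :: "'a \<Rightarrow> 'a \<Rightarrow> real \<Rightarrow> 'a"
    and T :: "'a \<Rightarrow> 'a" and p u y\<^sub>0 :: 'a
    and l :: real and lam \<beta> :: "nat \<Rightarrow> real" and y :: "nat \<Rightarrow> 'a" and M :: int
  assumes "W_hyperbolic_space X d W"
    and "W_convex X W C"
    and "T \<in> C \<rightarrow> C"
    and "nonexpansive_on C d T"
    and "p \<in> C" and "T p = p"
    and "u \<in> C" and "y\<^sub>0 \<in> C"
    and "l \<in> {0<..1}"
    and "\<And>n. lam n = l"
    and "\<beta> 1 = 0"
    and "\<And>n. n \<ge> 2 \<Longrightarrow> \<beta> n = 1 - 2 / real n"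
    and "y = modified_halpern W T u lam \<beta> y\<^sub>0"
    and "M \<ge> 1"
    and "real_of_int M \<ge> 4 * max (d u p) (d y\<^sub>0 p)"
  shows "\<forall>n. d (y (n + 1)) (y n) \<le> 2 * real_of_int M / (real n + 1) \<and>
             d (y n) (T (y n)) \<le> 4 * real_of_int M / (l * (real n + 1))"
proof -
  interpret W_hyperbolic_space X d W by fact
  have CX: "C \<subseteq> X" and Wcl: "\<And>a b t. a \<in> C \<Longrightarrow> b \<in> C \<Longrightarrow> t \<in> {0..1} \<Longrightarrow> W a b t \<in> C"
    using assms(2) by (auto simp: W_convex_def)
  have l: "0 < l" "l \<in> {0..1}"
    using assms(9) by auto
  define K where "K = max (d u p) (d y\<^sub>0 p)"
  have K: "4 * K \<le> M" "d u p \<le> K" "d y\<^sub>0 p \<le> K"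
    using assms(15) by (auto simp: K_def)
  have \<beta>_Suc_Suc: "\<beta> (Suc (Suc n)) = real n / (real n + 2)" for n
    using assms(12)[of "Suc (Suc n)"] by (simp add: field_simps)
  \<comment> \<open>The case \<open>n = 0\<close> is separate because \<open>\<beta> 1\<close> is
    set to 0, whereas 1 - 2/n would give -1 at n = 1.\<close>
  have \<beta>: "\<beta> (Suc n) \<in> {0..1}" for n
    using assms(11) by (cases n) (simp_all add: \<beta>_Suc_Suc)
  have \<beta>_compl: "1 - \<beta> (Suc n) \<le> 2 / (real n + 1)" for n
    using assms(11) by (cases n) (simp_all add: \<beta>_Suc_Suc field_simps)
  \<comment> \<open>Equality for n \<ge> 1; for n = 0 the left side is 0, as
    \<open>\<beta> 1\<close> and \<open>\<beta> 2\<close> both vanish.\<close>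
  have \<beta>_diff: "\<bar>\<beta> (Suc (Suc n)) - \<beta> (Suc n)\<bar> \<le> 2 / ((real n + 1) * (real n + 2))" for n
  proof (cases n)
    case 0
    then show ?thesis using assms(11) \<beta>_Suc_Suc[of 0] by simp
  next
    case (Suc m)
    have "\<beta> (Suc (Suc n)) - \<beta> (Suc n) = 2 / ((real n + 1) * (real n + 2))"
      unfolding Suc \<beta>_Suc_Suc by (simp add: divide_simps) (simp add: algebra_simps)
    then show ?thesis by simp
  qed
  define v where "v n = W (y n) (T (y n)) l" for n
  have y_0: "y 0 = y\<^sub>0" and y_Suc: "y (Suc n) = W u (v n) (\<beta> (Suc n))" for n
    by (simp_all add: assms(10,13) v_def Let_def)
  have lam: "lam n \<in> {0..1}" for n
    using l by (simp add: assms(10))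
  have yC: "y n \<in> C" and yp: "d (y n) p \<le> K" for n
    unfolding assms(13)
    using modified_halpern_bounded[where lam = lam and \<beta> = \<beta>, OF assms(2-7) K(2) assms(8) K(3) lam \<beta>]
    by auto
  have TyC: "T (y n) \<in> C" for n
    using yC assms(3) by auto
  have vC: "v n \<in> C" for n
    unfolding v_def using yC TyC l by (intro Wcl) auto
  have inX: "u \<in> X" "p \<in> X" "y\<^sub>0 \<in> X" "y n \<in> X" "T (y n) \<in> X" "v n \<in> X" for n
    using assms CX yC TyC vC by auto
  have vp: "d (v n) p \<le> K" for n
    unfolding v_def using averaged_bounded[OF CX assms(3-6) yC yp l(2)] .
  \<comment> \<open>The ball has diameter at most 2 K, and 4 K \<le> M.\<close>
  have diam: "d a b \<le> M / 2" if "a \<in> X" "b \<in> X" "d a p \<le> K" "d b p \<le> K" for a b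
    using triangle[of a p b] that inX K(1) by (simp add: commute)
  have uv: "d u (v n) \<le> M / 2" for n
    by (rule diam) (use inX vp K in auto)
  have s: "d (y (Suc n)) (y n) \<le> 2 * M / (real n + 1)" for n
  proof (induction n)
    case 0
    have "d (y (Suc 0)) (y 0) \<le> M / 2"
      by (rule diam) (use inX yp in auto)
    then show ?case using assms(14) by simp
  next
    case (Suc n)
    have vv: "d (v (Suc n)) (v n) \<le> d (y (Suc n)) (y n)"
      unfolding v_def using nonexpansive_averaged[OF CX assms(3,4) yC yC l(2)] .
    have "d (y (Suc (Suc n))) (y (Suc n))
        \<le> \<beta> (Suc (Suc n)) * d (v (Suc n)) (v n) + \<bar>\<beta> (Suc (Suc n)) - \<beta> (Suc n)\<bar> * d u (v n)"
      unfolding y_Suc[of "Suc n"] y_Suc[of n]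
      by (rule dist_W_W_le[OF inX(1,6,6) \<beta> \<beta>])
    also have "\<dots> \<le> real n / (real n + 2) * (2 * M / (real n + 1))
        + 2 / ((real n + 1) * (real n + 2)) * (M / 2)"
      using vv Suc.IH uv[of n] \<beta>_diff[of n] by (intro add_mono mult_mono) (auto simp: \<beta>_Suc_Suc)
    also have "\<dots> = M * (2 * real n + 1) / ((real n + 1) * (real n + 2))"
      by (simp add: divide_simps) (simp add: algebra_simps)
    \<comment> \<open>Raising 2n + 1 to 2n + 2 lets the factor n + 1 cancel, which closes the
      induction.\<close>
    also have "\<dots> \<le> M * (2 * (real n + 1)) / ((real n + 1) * (real n + 2))"
      using assms(14) by (intro divide_right_mono mult_left_mono) auto
    also have "\<dots> = 2 * M / (real (Suc n) + 1)"
      by (simp add: divide_simps) (simp add: algebra_simps)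
    finally show ?case .
  qed
  have "d (y n) (T (y n)) \<le> 4 * M / (l * (real n + 1))" for n
  proof -
    have "l * d (y n) (T (y n)) = d (y n) (v n)"
      unfolding v_def using dist_W_left inX l by simp
    also have "\<dots> \<le> d (y n) (y (Suc n)) + d (y (Suc n)) (v n)"
      using inX by (intro triangle) auto
    also have "d (y (Suc n)) (v n) = (1 - \<beta> (Suc n)) * d u (v n)"
      unfolding y_Suc using inX \<beta> by (intro dist_W_right) auto
    also have "d (y n) (y (Suc n)) + \<dots> \<le> 2 * M / (real n + 1) + 2 / (real n + 1) * (M / 2)"
      using s[of n] \<beta>_compl[of n] uv[of n] \<beta>[of n]
      by (intro add_mono mult_mono) (auto simp: commute)
    also have "\<dots> = 3 * M / (real n + 1)"
      by (simp add: divide_simps)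
    \<comment> \<open>The two contributions are 2 M and M; their sum is relaxed to the stated
      constant.\<close>
    also have "\<dots> \<le> 4 * M / (real n + 1)"
      using assms(14) by (intro divide_right_mono) auto
    finally show ?thesis
      using l(1) by (simp add: pos_le_divide_eq mult_ac)
  qed
  with s show ?thesis by simp
qed

end
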